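(* Let $(a,b)\in\mathbb{R}^2$ be a good pair with translation number $\lambda>1$, let $n\ge 2$, and let $x_0,x_1,\dots,x_n\in\mathbb{H}^2$ be an $(a,b)$-good chain. Then $$\left|\tau(x_0,\dots,x_n)\right|\leq (n-2)\,\frac{2}{\lambda-1}.$$
   Context: $\mathbb{H}^2=\{z\in\mathbb{C}:\operatorname{Im} z>0\}$ is the hyperbolic upper half plane with Riemannian metric $|dz|^2/\operatorname{Im}(z)^2$ and induced distance $d$. A chain is an ordered tuple of points. The tension of a chain $x_0,\dots,x_n$ is $$\tau(x_0,\dots,x_n)=\sum_{j=1}^{n-1}d(x_{j-1},x_{j+1})-\sum_{j=2}^{n-1}d(x_{j-1},x_j)-d(x_0,x_n).$$ The Gromov product is $\langle x|y\rangle_z=\frac{d(x,z)+d(z,y)-d(x,y)}{2}$. A pair $(a,b)\in\mathbb{R}^2$ is good if $a,b\ge 0$ and $\sinh(a-b)>2\sinh(a/2)$. For a good pair $(a,b)$, a chain $x_0,\dots,x_n$ is $(a,b)$-good if $d(x_{j+1},x_j)\ge a$ for $0\le j\le n-1$ and $\langle x_{j-1}|x_{j+1}\rangle_{x_j}\le b$ for $1\le j\le n-1$. The translation number of a good pair $(a,b)$ is the unique $\lambda>1$ with $\cosh\left(\frac{\log\lambda}{2}\right)=\frac{\sinh(a-b)}{2\sinh(a/2)}$. *)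

theory Defs
  imports "HOL-Analysis.Analysis"
begin

definition upper_half_plane :: "complex set" where
  "upper_half_plane = {z. Im z > 0}"

(* Lengths, for the metric |dz|^2 / Im(z)^2, of the rectifiable piecewise C^1 paths in the upper
   half plane from z to w. The library's valid_path allows the derivative to be unbounded near the
   break points, so a path may have infinite length; has_integral excludes such paths, whereas the
   total function integral would give them length 0. *)
definition hyp_path_lengths :: "complex \<Rightarrow> complex \<Rightarrow> real set" where
  "hyp_path_lengths z w =
     {L. \<exists>g. valid_path g \<and> path_image g \<subseteq> upper_half_plane \<and> pathstart g = z \<and> pathfinish g = w \<and>
          ((\<lambda>t. norm (vector_derivative g (at t)) / Im (g t)) has_integral L) {0..1}}"

definition hyp_dist :: "complex \<Rightarrow> complex \<Rightarrow> real" where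
  "hyp_dist z w = Inf (hyp_path_lengths z w)"

definition gromov_product :: "complex \<Rightarrow> complex \<Rightarrow> complex \<Rightarrow> real" where
  "gromov_product x y z = (hyp_dist x z + hyp_dist z y - hyp_dist x y) / 2"

(* A chain x_0, ..., x_n is given by n and a sequence of which only the terms up to n matter. *)
definition tension :: "nat \<Rightarrow> (nat \<Rightarrow> complex) \<Rightarrow> real" where
  "tension n x =
     (\<Sum>j=1..n-1. hyp_dist (x (j-1)) (x (j+1))) - (\<Sum>j=2..n-1. hyp_dist (x (j-1)) (x j))
     - hyp_dist (x 0) (x n)"

definition good_pair :: "real \<Rightarrow> real \<Rightarrow> bool" where
  "good_pair a b \<longleftrightarrow> a \<ge> 0 \<and> b \<ge> 0 \<and> sinh (a - b) > 2 * sinh (a / 2)"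

definition good_chain :: "real \<Rightarrow> real \<Rightarrow> nat \<Rightarrow> (nat \<Rightarrow> complex) \<Rightarrow> bool" where
  "good_chain a b n x \<longleftrightarrow>
     (\<forall>j\<le>n. x j \<in> upper_half_plane) \<and>
     (\<forall>j<n. hyp_dist (x (j+1)) (x j) \<ge> a) \<and>
     (\<forall>j\<in>{1..n-1}. gromov_product (x (j-1)) (x (j+1)) (x j) \<le> b)"

definition translation_number :: "real \<Rightarrow> real \<Rightarrow> real" where
  "translation_number a b =
     (THE l. l > 1 \<and> cosh (ln l / 2) = sinh (a - b) / (2 * sinh (a / 2)))"

end

(* Appending x_n to a chain changes the tension by T = d(y,q) + d(p,r) - d(p,q) - d(y,r), where
   y = x_0 and p, q, r = x_(n-2), x_(n-1), x_n; so it suffices to show |T| <= 2/(l - 1).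
   In the half plane sinh(d(z,w)/2) and cosh(d(z,w)/2) are |z - w| and |z - cnj w|, both divided by
   2 sqrt(Im z Im w), so the identity (y-q)(p-r) = (y-p)(q-r) + (y-r)(p-q), with some of the points
   conjugated, gives Ptolemy inequalities between them. One of these shows by induction along the
   chain that exp((d(x_0,x_(j+1)) - d(x_0,x_j))/2) stays above a constant Z > 0 depending only on
   (a, b). The others bound exp(T/2) and exp(-T/2) in terms of
   Y = exp((d(y,p) + d(q,r) - d(y,q) - d(p,r))/2) <= exp(b - d(p,q)/2)/Z:
   exp(T/2) (1 - Y) <= 1 - exp(-d(p,q)) and exp(-T/2) <= 1 + Y (1 - exp(-d(q,r))).
   Both right-hand sides lead to exp(|T|/2) <= 1 + 1/(l - 1) <= exp(1/(l - 1)). *)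
theory Submission
  imports Defs
begin

section \<open>Invariance of the distance under real Moebius maps\<close>

text \<open>The real Moebius map of determinant 1 that sends \<open>c\<close> to infinity and
  infinity to \<open>e\<close>. With two parameters the family is closed under inversion:
  \<open>mob e c\<close> undoes \<open>mob c e\<close>.\<close>

definition mob :: "real \<Rightarrow> real \<Rightarrow> complex \<Rightarrow> complex" where
  "mob c e p = of_real e - 1 / (p - of_real c)"

lemma Im_mob: "Im (mob c e p) = Im p / (norm (p - of_real c))\<^sup>2"
  by (simp add: mob_def Im_divide cmod_power2)

lemma mob_diff:
  assumes "p \<noteq> of_real c" "q \<noteq> of_real c"
  shows "mob c e p - mob c e q = (p - q) / ((p - of_real c) * (q - of_real c))"
  using assms by (simp add: mob_def field_simps)

lemma mob_mob: "p \<noteq> of_real c \<Longrightarrow> mob e c (mob c e p) = p"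
  by (simp add: mob_def)

lemma upper_half_plane_not_real: "p \<in> upper_half_plane \<Longrightarrow> p \<noteq> of_real c"
  by (auto simp: upper_half_plane_def)

lemma mob_upper_half_plane: "p \<in> upper_half_plane \<Longrightarrow> mob c e p \<in> upper_half_plane"
  using upper_half_plane_not_real[of p c] by (simp add: upper_half_plane_def Im_mob)

lemma mob_has_field_derivative:
  "p \<noteq> of_real c \<Longrightarrow> (mob c e has_field_derivative 1 / (p - of_real c)\<^sup>2) (at p)"
  unfolding mob_def [abs_def]
  by (auto intro!: derivative_eq_intros simp: power2_eq_square field_simps)

text \<open>The derivative of \<open>mob c e\<close> at \<open>p\<close> has modulus
  \<open>1 / |p - c|^2\<close>, the very factor by which \<open>Im_mob\<close> rescales the
  imaginary part, so the integrand is unchanged off a finite set.\<close>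

lemma hyp_path_lengths_mob_subset:
  "hyp_path_lengths z w \<subseteq> hyp_path_lengths (mob c e z) (mob c e w)"
proof
  fix L assume "L \<in> hyp_path_lengths z w"
  then obtain g where g: "valid_path g" "path_image g \<subseteq> upper_half_plane"
      "pathstart g = z" "pathfinish g = w"
      and L: "((\<lambda>t. norm (vector_derivative g (at t)) / Im (g t)) has_integral L) {0..1}"
    by (auto simp: hyp_path_lengths_def)
  have nr: "p \<noteq> of_real c" if "p \<in> path_image g" for p
    using g that upper_half_plane_not_real by blast
  have der: "(mob c e has_field_derivative 1 / (p - of_real c)\<^sup>2) (at p)"
    if "p \<in> path_image g" for p
    by (rule mob_has_field_derivative[OF nr[OF that]])
  have "continuous_on (path_image g) (\<lambda>p. 1 / (p - of_real c)\<^sup>2)"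
    using nr by (intro continuous_intros) auto
  then have "continuous_on (path_image g) (deriv (mob c e))"
    by (subst continuous_on_cong[OF refl DERIV_imp_deriv[OF der]])
  then have valid: "valid_path (mob c e \<circ> g)"
    using g(1) der by (intro valid_path_compose) (auto simp: field_differentiable_def)
  obtain S where S: "finite S" "\<And>t. t \<in> {0..1} - S \<Longrightarrow> g differentiable at t"
    using g(1) unfolding valid_path_def piecewise_C1_differentiable_on_def C1_differentiable_on_eq
    by blast
  have "norm (vector_derivative (mob c e \<circ> g) (at t)) / Im ((mob c e \<circ> g) t)
      = norm (vector_derivative g (at t)) / Im (g t)" if t: "t \<in> {0..1} - S" for t
  proof -
    have im: "g t \<in> path_image g"
      using t by (auto simp: path_image_def)
    have "vector_derivative (mob c e \<circ> g) (at t)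
        = vector_derivative g (at t) * (1 / (g t - of_real c)\<^sup>2)"
      using S(2)[OF t] der[OF im]
      by (intro vector_derivative_at field_vector_diff_chain_at) (simp_all add: vector_derivative_works)
    then show ?thesis
      using nr[OF im] by (simp add: Im_mob norm_mult norm_divide norm_power)
  qed
  from has_integral_spike_finite[OF S(1) this L]
  have "((\<lambda>t. norm (vector_derivative (mob c e \<circ> g) (at t)) / Im ((mob c e \<circ> g) t))
      has_integral L) {0..1}" .
  moreover have "path_image (mob c e \<circ> g) \<subseteq> upper_half_plane"
    using g(2) mob_upper_half_plane by (force simp: path_image_compose)
  ultimately show "L \<in> hyp_path_lengths (mob c e z) (mob c e w)"
    using valid g(3,4) by (auto simp: hyp_path_lengths_def pathstart_compose pathfinish_compose)
qed

text \<open>The reverse inclusion of the length sets comes from the inverse map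
  \<open>mob e c\<close>.\<close>

lemma hyp_dist_mob:
  assumes "z \<in> upper_half_plane" "w \<in> upper_half_plane"
  shows "hyp_dist (mob c e z) (mob c e w) = hyp_dist z w"
proof -
  have "hyp_path_lengths (mob c e z) (mob c e w) \<subseteq> hyp_path_lengths z w"
    using hyp_path_lengths_mob_subset[of "mob c e z" "mob c e w" e c] assms
    by (simp add: mob_mob upper_half_plane_not_real)
  then show ?thesis
    using hyp_path_lengths_mob_subset[of z w c e] by (simp add: hyp_dist_def)
qed

section \<open>Distance along vertical lines\<close>

text \<open>The integrand dominates the absolute value of the derivative of
  \<open>ln (Im (g t))\<close>, so its integral bounds the total change of that function.\<close>

lemma hyp_path_length_ge:
  assumes "L \<in> hyp_path_lengths z w"
  shows "\<bar>ln (Im w) - ln (Im z)\<bar> \<le> L"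
proof -
  obtain g where g: "valid_path g" "path_image g \<subseteq> upper_half_plane"
      "pathstart g = z" "pathfinish g = w"
      and L: "((\<lambda>t. norm (vector_derivative g (at t)) / Im (g t)) has_integral L) {0..1}"
    using assms by (auto simp: hyp_path_lengths_def)
  have pos: "Im (g t) > 0" if "t \<in> {0..1}" for t
    using g(2) that by (force simp: path_image_def upper_half_plane_def)
  obtain S where S: "finite S" "\<And>t. t \<in> {0..1} - S \<Longrightarrow> g differentiable at t"
    using g(1) unfolding valid_path_def piecewise_C1_differentiable_on_def C1_differentiable_on_eq
    by blast
  have cont: "continuous_on {0..1} g"
    using g(1) by (simp add: valid_path_def piecewise_C1_differentiable_on_def)
  have "((\<lambda>t. Im (vector_derivative g (at t)) / Im (g t)) has_integral
      (ln (Im (g 1)) - ln (Im (g 0)))) {0..1}"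
  proof (rule fundamental_theorem_of_calculus_interior_strong[OF S(1)])
    show "continuous_on {0..1} (\<lambda>t. ln (Im (g t)))"
      using cont pos by (intro continuous_intros) force+
    fix t :: real assume t: "t \<in> {0<..<1} - S"
    have "(g has_vector_derivative vector_derivative g (at t)) (at t)"
      using S(2)[of t] t by (simp add: vector_derivative_works)
    then have "((\<lambda>t. Im (g t)) has_real_derivative Im (vector_derivative g (at t))) (at t)"
      by (simp add: has_vector_derivative_def has_field_derivative_def bounded_linear_Im
            bounded_linear.has_derivative[OF bounded_linear_Im, THEN has_derivative_eq_rhs]
            fun_eq_iff mult.commute)
    then show "((\<lambda>t. ln (Im (g t))) has_vector_derivative
        Im (vector_derivative g (at t)) / Im (g t)) (at t)"
      using DERIV_ln_divide[of "Im (g t)"] DERIV_chain2 pos[of t] t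
      unfolding has_real_derivative_iff_has_vector_derivative[symmetric] by fastforce
  qed simp
  then have I: "((\<lambda>t. Im (vector_derivative g (at t)) / Im (g t)) has_integral
      (ln (Im w) - ln (Im z))) {0..1}"
    using g(3,4) by (simp add: pathstart_def pathfinish_def)
  have le: "\<bar>Im (vector_derivative g (at t)) / Im (g t)\<bar>
      \<le> norm (vector_derivative g (at t)) / Im (g t)" if "t \<in> {0..1}" for t
    using pos[OF that] by (simp add: abs_divide divide_right_mono abs_Im_le_cmod)
  have "ln (Im w) - ln (Im z) \<le> L"
    using has_integral_le[OF I L] le by (smt (verit))
  moreover have "- (ln (Im w) - ln (Im z)) \<le> L"
    using has_integral_le[OF has_integral_neg[OF I] L] le by (smt (verit))
  ultimately show ?thesis by simp
qed

text \<open>The height changes monotonically along the straight segment, so the bound of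
  \<open>hyp_path_length_ge\<close> is attained.\<close>

lemma vertical_path_length:
  assumes "z \<in> upper_half_plane" "w \<in> upper_half_plane" "Re z = Re w"
  shows "\<bar>ln (Im w) - ln (Im z)\<bar> \<in> hyp_path_lengths z w"
proof -
  \<comment> \<open>The sign turns \<open>Im w - Im z\<close> into \<open>norm (w - z)\<close>; it
    is 0 exactly when \<open>z = w\<close>, where the length is 0 too.\<close>
  let ?s = "sgn (Im w - Im z)"
  have pos: "Im (linepath z w t) > 0" if "t \<in> {0..1}" for t
  proof -
    have "convex {p. Im p > 0}" by (rule convex_halfspace_Im_gt)
    then have "closed_segment z w \<subseteq> {p. Im p > 0}"
      using assms(1,2) by (intro closed_segment_subset) (auto simp: upper_half_plane_def)
    then show ?thesis using that linepath_in_path[of t z w] by auto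
  qed
  have der: "((\<lambda>t. ?s * ln (Im (linepath z w t))) has_vector_derivative
      ?s * ((Im w - Im z) / Im (linepath z w t))) (at t within {0..1})" if "t \<in> {0..1}" for t
    unfolding has_real_derivative_iff_has_vector_derivative[symmetric]
    using pos[OF that]
    by (auto intro!: derivative_eq_intros simp: linepath_def)
  have "((\<lambda>t. ?s * ((Im w - Im z) / Im (linepath z w t))) has_integral
      (?s * ln (Im (linepath z w 1)) - ?s * ln (Im (linepath z w 0)))) {0..1}"
    by (rule fundamental_theorem_of_calculus[OF _ der]) auto
  moreover have "?s * ln (Im (linepath z w 1)) - ?s * ln (Im (linepath z w 0))
      = \<bar>ln (Im w) - ln (Im z)\<bar>"
    using assms(1,2) by (auto simp: upper_half_plane_def sgn_if linepath_def)
  moreover have "norm (w - z) = ?s * (Im w - Im z)"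
    using assms(3) by (simp add: cmod_def sgn_if)
  then have "(\<lambda>t. ?s * ((Im w - Im z) / Im (linepath z w t)))
      = (\<lambda>t. norm (vector_derivative (linepath z w) (at t)) / Im (linepath z w t))"
    by simp
  ultimately have I: "((\<lambda>t. norm (vector_derivative (linepath z w) (at t)) / Im (linepath z w t))
      has_integral \<bar>ln (Im w) - ln (Im z)\<bar>) {0..1}"
    by (simp only:)
  have "path_image (linepath z w) \<subseteq> upper_half_plane"
    using pos by (auto simp: path_image_def upper_half_plane_def)
  with I show ?thesis unfolding hyp_path_lengths_def
    by (auto intro!: exI[of _ "linepath z w"])
qed

lemma hyp_dist_vertical:
  assumes "z \<in> upper_half_plane" "w \<in> upper_half_plane" "Re z = Re w"
  shows "hyp_dist z w = \<bar>ln (Im w) - ln (Im z)\<bar>"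
  unfolding hyp_dist_def
  using vertical_path_length[OF assms] hyp_path_length_ge by (rule cInf_eq_minimum)

section \<open>The half-distance formulas for arbitrary points\<close>

text \<open>Unlike the logarithmic formula, the one for \<open>sinh\<close> is invariant under
  \<open>mob\<close>, which lets it be carried over to all pairs of points.\<close>

lemma sinh_hyp_dist_vertical:
  assumes "z \<in> upper_half_plane" "w \<in> upper_half_plane" "Re z = Re w"
  shows "hyp_dist z w \<ge> 0"
    "sinh (hyp_dist z w / 2) = norm (z - w) / (2 * sqrt (Im z * Im w))"
proof -
  have pos: "Im z > 0" "Im w > 0" using assms by (auto simp: upper_half_plane_def)
  have S: "sinh (\<bar>ln v - ln u\<bar> / 2) = \<bar>u - v\<bar> / (2 * sqrt (u * v))"
    if "u > 0" "v > 0" for u v :: real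
  proof -
    have *: "sinh ((ln v - ln u) / 2) = (v - u) / (2 * sqrt (u * v))"
      if "u > 0" "v > 0" for u v :: real
    proof -
      have "exp ((ln v - ln u) / 2) = sqrt v / sqrt u" if "u > 0" "v > 0" for u v :: real
        using that by (simp add: ln_sqrt[symmetric] diff_divide_distrib exp_diff)
      from this[OF that] this[OF that(2) that(1)]
      have "sinh ((ln v - ln u) / 2) = (sqrt v / sqrt u - sqrt u / sqrt v) / 2"
        by (simp add: sinh_def exp_minus[symmetric] minus_divide_left)
      also have "\<dots> = (v - u) / (2 * sqrt (u * v))"
        using that by (simp add: real_sqrt_mult field_simps)
      finally show ?thesis .
    qed
    show ?thesis
    proof (cases "u \<le> v")
      case True
      then show ?thesis using *[OF that] that by simp
    next
      case False
      then show ?thesis using *[OF that(2) that(1)] that by (simp add: mult.commute)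
    qed
  qed
  show "hyp_dist z w \<ge> 0" using hyp_dist_vertical[OF assms] by simp
  have "norm (z - w) = \<bar>Im z - Im w\<bar>"
    using assms(3) by (simp add: cmod_def)
  then show "sinh (hyp_dist z w / 2) = norm (z - w) / (2 * sqrt (Im z * Im w))"
    using S[OF pos] hyp_dist_vertical[OF assms] by simp
qed

text \<open>The geodesic through \<open>z\<close> and \<open>w\<close> is a half circle with centre \<open>m\<close> and radius \<open>R\<close>; sending
  its end point \<open>m - R\<close> to infinity makes it vertical.\<close>
lemma exists_mob_vertical:
  assumes "z \<in> upper_half_plane" "w \<in> upper_half_plane" "Re z \<noteq> Re w"
  obtains c where "Re (mob c 0 z) = Re (mob c 0 w)"
proof -
  \<comment> \<open>The real solution of \<open>|z - m| = |w - m|\<close>, an equation that is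
    linear in \<open>m\<close> after squaring.\<close>
  define m where "m = ((norm z)\<^sup>2 - (norm w)\<^sup>2) / (2 * (Re z - Re w))"
  define R where "R = norm (z - of_real m)"
  have "2 * (Re z - Re w) * m = (norm z)\<^sup>2 - (norm w)\<^sup>2"
    using assms(3) by (simp add: m_def)
  then have eq: "(norm (z - of_real m))\<^sup>2 = (norm (w - of_real m))\<^sup>2"
    unfolding cmod_power2 by (simp add: power2_eq_square algebra_simps)
  \<comment> \<open>With \<open>u = Re p - m + R\<close> the circle equation reads
    \<open>u^2 + (Im p)^2 = 2 * R * u\<close>, so the real part
    \<open>- u / (u^2 + (Im p)^2)\<close> of the image does not depend on \<open>p\<close>.\<close>
  have "Re (mob (m - R) 0 p) = - 1 / (2 * R)"
    if p: "p \<in> upper_half_plane" "(norm (p - of_real m))\<^sup>2 = R\<^sup>2" for p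
  proof -
    have Rp: "R = norm (p - of_real m)" using p(2) by (simp add: R_def)
    have sq: "(Re p - m)\<^sup>2 + (Im p)\<^sup>2 = R\<^sup>2" using p(2) by (simp add: cmod_power2)
    have "R > 0" using upper_half_plane_not_real[OF p(1), of m] Rp by simp
    have "Re p - m + R > 0"
    proof -
      have "0 < (Im p)\<^sup>2" using p(1) by (simp add: upper_half_plane_def)
      then have "(Re p - m)\<^sup>2 < R\<^sup>2" using sq by linarith
      then have "\<bar>Re p - m\<bar>\<^sup>2 < R\<^sup>2" by simp
      then have "\<bar>Re p - m\<bar> < R" by (rule power2_less_imp_less) (use \<open>R > 0\<close> in simp)
      then show ?thesis by linarith
    qed
    moreover have "(Re p - m + R)\<^sup>2 + (Im p)\<^sup>2 = 2 * R * (Re p - m + R)"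
      using sq by (simp add: power2_eq_square algebra_simps)
    moreover have "Re (mob (m - R) 0 p) = - ((Re p - m + R) / ((Re p - m + R)\<^sup>2 + (Im p)\<^sup>2))"
      by (simp add: mob_def Re_divide algebra_simps)
    ultimately show ?thesis using \<open>R > 0\<close> by simp
  qed
  then have "Re (mob (m - R) 0 z) = Re (mob (m - R) 0 w)"
    using assms eq by (simp add: R_def)
  then show thesis by (rule that)
qed

text \<open>Under \<open>mob c 0\<close> both \<open>norm (z - w)\<close> and
  \<open>sqrt (Im z * Im w)\<close> are divided by \<open>|z - c| * |w - c|\<close>. Their quotient
  is therefore as invariant as the distance, and two points on a vertical line suffice.\<close>

lemma sinh_hyp_dist:
  assumes z: "z \<in> upper_half_plane" and w: "w \<in> upper_half_plane"
  shows "hyp_dist z w \<ge> 0"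
    and "sinh (hyp_dist z w / 2) = norm (z - w) / (2 * sqrt (Im z * Im w))"
proof -
  have "hyp_dist z w \<ge> 0 \<and> sinh (hyp_dist z w / 2) = norm (z - w) / (2 * sqrt (Im z * Im w))"
  proof (cases "Re z = Re w")
    case True
    then show ?thesis using sinh_hyp_dist_vertical assms by blast
  next
    case False
    then obtain c where "Re (mob c 0 z) = Re (mob c 0 w)"
      using exists_mob_vertical assms by blast
    note v = sinh_hyp_dist_vertical[OF mob_upper_half_plane[OF z] mob_upper_half_plane[OF w] this]
    have nz: "z \<noteq> of_real c" "w \<noteq> of_real c"
      using assms upper_half_plane_not_real by blast+
    have "sqrt (Im (mob c 0 z) * Im (mob c 0 w))
        = sqrt (Im z * Im w) / (norm (z - of_real c) * norm (w - of_real c))"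
      by (simp add: Im_mob real_sqrt_mult real_sqrt_divide)
    then show ?thesis
      using v nz by (simp add: hyp_dist_mob[OF z w] mob_diff norm_mult norm_divide)
  qed
  then show "hyp_dist z w \<ge> 0"
    and "sinh (hyp_dist z w / 2) = norm (z - w) / (2 * sqrt (Im z * Im w))" by blast+
qed

text \<open>This is \<open>cosh^2 = 1 + sinh^2\<close> together with
  \<open>|z - cnj w|^2 = |z - w|^2 + 4 * Im z * Im w\<close>.\<close>

lemma cosh_hyp_dist:
  assumes z: "z \<in> upper_half_plane" and w: "w \<in> upper_half_plane"
  shows "cosh (hyp_dist z w / 2) = norm (z - cnj w) / (2 * sqrt (Im z * Im w))"
proof (rule power2_eq_imp_eq)
  have pos: "Im z > 0" "Im w > 0" using assms by (auto simp: upper_half_plane_def)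
  then show "(cosh (hyp_dist z w / 2))\<^sup>2 = (norm (z - cnj w) / (2 * sqrt (Im z * Im w)))\<^sup>2"
    by (simp add: cosh_square_eq sinh_hyp_dist(2)[OF z w] power_divide cmod_power2
        power_mult_distrib field_simps) (simp add: power2_eq_square algebra_simps)
  show "0 \<le> norm (z - cnj w) / (2 * sqrt (Im z * Im w))" using pos by simp
qed simp


text \<open>Read off from the symmetric formula for \<open>sinh\<close>, which is injective; no path
  is reversed.\<close>

lemma hyp_dist_commute:
  assumes "z \<in> upper_half_plane" "w \<in> upper_half_plane"
  shows "hyp_dist z w = hyp_dist w z"
proof -
  from assms have "sinh (hyp_dist z w / 2) = sinh (hyp_dist w z / 2)"
    by (simp add: sinh_hyp_dist(2) norm_minus_commute mult.commute)
  then show ?thesis by simp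
qed

lemma hyp_dist_self: "z \<in> upper_half_plane \<Longrightarrow> hyp_dist z z = 0"
  using sinh_hyp_dist(2)[of z z] by simp

section \<open>Ptolemy inequalities\<close>

lemma ptolemy_norm:
  fixes y p q r :: complex
  shows "norm (y - q) * norm (p - r) \<le> norm (y - p) * norm (q - r) + norm (y - r) * norm (p - q)"
proof -
  have "(y - q) * (p - r) = (y - p) * (q - r) + (y - r) * (p - q)"
    by (simp add: algebra_simps)
  then show ?thesis
    by (metis norm_mult norm_triangle_ineq)
qed

text \<open>\<open>ptolemy_norm\<close> with none, one or both of \<open>y\<close> and
  \<open>r\<close> conjugated. A conjugated point turns \<open>S\<close> into \<open>K\<close> in
  its factors, except that \<open>S y r\<close> returns when both are conjugated.\<close>

lemma hyp_ptolemy: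
  assumes "y \<in> upper_half_plane" "p \<in> upper_half_plane" "q \<in> upper_half_plane" "r \<in> upper_half_plane"
  defines "S \<equiv> \<lambda>u v. sinh (hyp_dist u v / 2)" and "K \<equiv> \<lambda>u v. cosh (hyp_dist u v / 2)"
  shows "S y q * S p r \<le> S y p * S q r + S y r * S p q"
    and "K y q * S p r \<le> K y p * S q r + K y r * S p q"
    and "S y q * K p r \<le> S y p * K q r + K y r * S p q"
    and "K y q * K p r \<le> K y p * K q r + S y r * S p q"
proof -
  \<comment> \<open>One factor per point gives all three products the same denominator
    \<open>4 * s y * s p * s q * s r\<close>.\<close>
  define s where "s u = sqrt (Im u)" for u
  have S: "S u v = norm (u - v) / (2 * s u * s v)" and K: "K u v = norm (u - cnj v) / (2 * s u * s v)"
    if "u \<in> {y, p, q, r}" "v \<in> {y, p, q, r}" for u v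
    using that assms(1-4) sinh_hyp_dist(2)[of u v] cosh_hyp_dist[of u v]
    by (auto simp: S_def K_def s_def real_sqrt_mult mult.assoc)
  have "s u > 0" if "u \<in> {y, p, q, r}" for u
    using that assms(1-4) by (auto simp: s_def upper_half_plane_def)
  then have D: "0 \<le> 4 * s y * s p * s q * s r" by (simp add: less_imp_le)
  have c: "norm (cnj u - v) = norm (u - cnj v)" for u v
    by (metis complex_cnj_cnj complex_cnj_diff complex_mod_cnj)
  show "S y q * S p r \<le> S y p * S q r + S y r * S p q"
    using divide_right_mono[OF ptolemy_norm[of y q p r] D]
    by (simp add: S add_divide_distrib mult_ac)
  show "K y q * S p r \<le> K y p * S q r + K y r * S p q"
    using divide_right_mono[OF ptolemy_norm[of "cnj y" q p r] D]
    by (simp add: S K c add_divide_distrib mult_ac)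
  show "S y q * K p r \<le> S y p * K q r + K y r * S p q"
    using divide_right_mono[OF ptolemy_norm[of y q p "cnj r"] D]
    by (simp add: S K c add_divide_distrib mult_ac)
  show "K y q * K p r \<le> K y p * K q r + S y r * S p q"
    using divide_right_mono[OF ptolemy_norm[of "cnj y" q p "cnj r"] D]
    by (simp add: S K c add_divide_distrib mult_ac flip: complex_cnj_diff)
qed

text \<open>Since \<open>exp = sinh + cosh\<close>, adding the two inequalities of
  \<open>hyp_ptolemy\<close> in which \<open>r\<close> is not conjugated gives the first claim, and
  adding all four gives the second.\<close>

lemma exp_ptolemy:
  assumes "y \<in> upper_half_plane" "p \<in> upper_half_plane" "q \<in> upper_half_plane" "r \<in> upper_half_plane"
  defines "d \<equiv> hyp_dist"
  shows "exp (d y q / 2) * sinh (d p r / 2)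
      \<le> exp (d y p / 2) * sinh (d q r / 2) + exp (d y r / 2) * sinh (d p q / 2)"
    and "exp ((d y q + d p r) / 2)
      \<le> exp ((d y p + d q r) / 2) + 2 * exp (d y r / 2) * sinh (d p q / 2)"
proof -
  have e: "exp t = sinh t + cosh t" for t :: real
    by (simp add: sinh_plus_cosh)
  note P = hyp_ptolemy[OF assms(1-4), folded d_def]
  show "exp (d y q / 2) * sinh (d p r / 2)
      \<le> exp (d y p / 2) * sinh (d q r / 2) + exp (d y r / 2) * sinh (d p q / 2)"
    using P(1,2) unfolding e distrib_right by linarith
  show "exp ((d y q + d p r) / 2)
      \<le> exp ((d y p + d q r) / 2) + 2 * exp (d y r / 2) * sinh (d p q / 2)"
    using P unfolding add_divide_distrib exp_add unfolding e distrib_right distrib_left mult.assoc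
    by linarith
qed

section \<open>Inequalities between the constants of a good pair\<close>

text \<open>\<open>s\<close> is the case \<open>A = B = a\<close>, and \<open>c\<close> bounds the
  coefficient of \<open>sinh u\<close> in the addition formula when \<open>A\<close> grows to
  \<open>a + 2 * u\<close>. Growing \<open>B\<close> afterwards is easier, because its term carries
  \<open>1 / Z \<le> Z\<close>. For a triangle with sides \<open>A\<close>, \<open>B\<close> and
  Gromov product at most \<open>b\<close>, the right-hand side bounds \<open>sinh\<close> of half
  the third side from below.\<close>

lemma sinh_gromov_ge:
  fixes a b A B Z :: real
  assumes ab: "b \<le> a" and a: "0 \<le> a" and Z: "1 \<le> Z"
    and c: "Z * cosh (a / 2) \<le> cosh (a - b)" and s: "(Z + 1 / Z) * sinh (a / 2) \<le> sinh (a - b)"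
    and "a \<le> A" "a \<le> B"
  shows "Z * sinh (A / 2) + sinh (B / 2) / Z \<le> sinh ((A + B) / 2 - b)"
proof -
  define u v where "u = (A - a) / 2" and "v = (B - a) / 2"
  have uv: "u \<ge> 0" "v \<ge> 0" using assms by (auto simp: u_def v_def)
  have A: "A / 2 = a / 2 + u" and B: "B / 2 = a / 2 + v" and AB: "(A + B) / 2 - b = (a - b + u) + v"
    by (simp_all add: u_def v_def field_simps)
  have "Z * sinh (A / 2) + sinh (a / 2) / Z
      \<le> Z * sinh (A / 2) + sinh (a / 2) / Z * cosh u"
    using Z a cosh_real_ge_1[of u] by (simp add: mult_le_cancel_left1 divide_right_mono)
  also have "\<dots> = (Z + 1 / Z) * sinh (a / 2) * cosh u + Z * cosh (a / 2) * sinh u"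
    by (simp add: A sinh_add algebra_simps)
  also have "\<dots> \<le> sinh (a - b) * cosh u + cosh (a - b) * sinh u"
    using c s uv by (intro add_mono mult_right_mono) auto
  finally have 1: "Z * sinh (A / 2) + sinh (a / 2) / Z \<le> sinh (a - b + u)"
    by (simp add: sinh_add)
  have "cosh (a / 2) / Z \<le> Z * cosh (a / 2)"
    using Z by (simp add: field_simps mult_le_cancel_left1 one_le_power flip: power2_eq_square)
  also note c
  also have "cosh (a - b) \<le> cosh (a - b + u)"
    using ab uv by (subst cosh_real_nonneg_le_iff) auto
  finally have 2: "cosh (a / 2) / Z \<le> cosh (a - b + u)" .
  have "Z * sinh (A / 2) + sinh (B / 2) / Z
      = Z * sinh (A / 2) + sinh (a / 2) / Z * cosh v + cosh (a / 2) / Z * sinh v"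
    using Z by (simp add: B sinh_add add_divide_distrib)
  also have "\<dots> \<le> (Z * sinh (A / 2) + sinh (a / 2) / Z) * cosh v + cosh (a / 2) / Z * sinh v"
  proof -
    have "Z * sinh (A / 2) * 1 \<le> Z * sinh (A / 2) * cosh v"
      using Z a \<open>a \<le> A\<close> by (intro mult_left_mono cosh_real_ge_1) auto
    then show ?thesis by (simp add: distrib_right)
  qed
  also have "\<dots> \<le> sinh (a - b + u) * cosh v + cosh (a - b + u) * sinh v"
    using 1 2 uv by (intro add_mono mult_right_mono) auto
  finally show ?thesis by (simp add: AB sinh_add)
qed

text \<open>The definite description is meaningful: goodness makes the quotient \<open>?c\<close>
  exceed 1, and \<open>exp (2 * arcosh ?c)\<close> is then the only solution above 1.\<close>

lemma good_pair_translation_number: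
  assumes "good_pair a b"
  defines "l \<equiv> translation_number a b"
  shows "l > 1" "cosh (ln l / 2) = sinh (a - b) / (2 * sinh (a / 2))"
proof -
  let ?c = "sinh (a - b) / (2 * sinh (a / 2))"
  have ab: "a \<ge> 0" "b \<ge> 0" "sinh (a - b) > 2 * sinh (a / 2)"
    using assms by (auto simp: good_pair_def)
  \<comment> \<open>For \<open>a = 0\<close> goodness would say \<open>sinh (- b) > 0\<close>,
    against \<open>b \<ge> 0\<close>; so the denominator of \<open>?c\<close> is not 0.\<close>
  then have "a \<noteq> 0" by auto
  with ab have c: "?c > 1" by (simp add: divide_simps)
  have inv: "m = exp (2 * arcosh ?c)" if "m > 1" "cosh (ln m / 2) = ?c" for m
  proof -
    have "arcosh ?c = ln m / 2"
      unfolding that(2)[symmetric] using that(1) by (intro arcosh_cosh_real) auto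
    then have "2 * arcosh ?c = ln m" by simp
    then show ?thesis using that(1) by (simp only: exp_ln)
  qed
  have "cosh (arcosh ?c) = ?c" using c by (intro cosh_arcosh_real) simp
  moreover have "arcosh ?c \<ge> 0" using c by (intro arcosh_nonneg_real) simp
  moreover from calculation have "arcosh ?c \<noteq> 0" using c by (metis cosh_0 less_irrefl)
  ultimately have "exp (2 * arcosh ?c) > 1 \<and> cosh (ln (exp (2 * arcosh ?c)) / 2) = ?c"
    by (simp only: ln_exp) simp
  then have "l > 1 \<and> cosh (ln l / 2) = ?c"
    unfolding l_def translation_number_def by (rule theI) (use inv in blast)
  then show "l > 1" "cosh (ln l / 2) = ?c" by auto
qed

text \<open>The two terms of the minimum are what \<open>sinh_gromov_ge\<close> needs of \<open>Z\<close>: the first gives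
  \<open>Z + 1 / Z \<le> 2 cosh (ln \<lambda> / 2)\<close>, the case of equal sides \<open>a\<close>, and the second controls the growth
  when the sides get longer.\<close>
definition drift :: "real \<Rightarrow> real \<Rightarrow> real" where
  "drift a b = min (sqrt (translation_number a b)) (cosh (a - b) / cosh (a / 2))"

text \<open>The bounds on \<open>Z\<close> are the hypotheses of \<open>sinh_gromov_ge\<close>. The
  bound on \<open>l\<close> starts the induction along the chain and enters
  \<open>drift_decay\<close> as \<open>exp (2 * b - a) \<le> 1 / l\<close>.\<close>

lemma good_pair_drift:
  assumes gp: "good_pair a b"
  defines "l \<equiv> translation_number a b" and "Z \<equiv> drift a b"
  shows "0 < a" "2 * b < a" "1 \<le> Z" "Z * cosh (a / 2) \<le> cosh (a - b)"
    "(Z + 1 / Z) * sinh (a / 2) \<le> sinh (a - b)"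
    "l \<le> exp (a - 2 * b)"
proof -
  have ab: "a \<ge> 0" "b \<ge> 0" "sinh (a - b) > 2 * sinh (a / 2)"
    using assms by (auto simp: good_pair_def)
  then show "0 < a" by (cases "a = 0") auto
  then have S: "sinh (a / 2) > 0" by simp
  with ab have "sinh (a / 2) < sinh (a - b)" by linarith
  then show lt: "2 * b < a" by simp
  have l: "l > 1" "2 * cosh (ln l / 2) * sinh (a / 2) = sinh (a - b)"
    using good_pair_translation_number[OF gp] S by (simp_all add: l_def field_simps)
  have "cosh (a / 2) \<le> cosh (a - b)"
    using ab lt by (subst cosh_real_nonneg_le_iff) auto
  then show Z1: "1 \<le> Z" using l by (simp add: Z_def drift_def l_def)
  have "Z \<le> cosh (a - b) / cosh (a / 2)" by (simp add: Z_def drift_def)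
  then show "Z * cosh (a / 2) \<le> cosh (a - b)" by (simp add: field_simps)
  have Zl: "Z \<le> sqrt l" by (simp add: Z_def drift_def l_def)
  \<comment> \<open>The function \<open>t + 1 / t\<close> is increasing for
    \<open>t \<ge> 1\<close>; the product below is the factored difference.\<close>
  have "Z + 1 / Z \<le> sqrt l + 1 / sqrt l"
  proof -
    have "(sqrt l - Z) * (1 - 1 / (sqrt l * Z)) \<ge> 0"
      using Zl Z1 mult_mono[of 1 "sqrt l" 1 Z] l(1)
      by (intro mult_nonneg_nonneg) (auto simp: divide_le_eq)
    moreover have "(sqrt l - Z) * (1 - 1 / (sqrt l * Z)) = sqrt l - Z - 1 / Z + 1 / sqrt l"
      using Z1 l(1) by (simp add: left_diff_distrib right_diff_distrib diff_divide_distrib)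
    ultimately show ?thesis by linarith
  qed
  also have "\<dots> = 2 * cosh (ln l / 2)"
  proof -
    have "ln l / 2 = ln (sqrt l)" using l(1) by (simp add: ln_sqrt)
    moreover have "exp (ln (sqrt l)) = sqrt l" using l(1) by (intro exp_ln) simp
    ultimately have "exp (ln l / 2) = sqrt l" by (simp only:)
    then show ?thesis by (simp add: cosh_field_def exp_minus inverse_eq_divide)
  qed
  finally show "(Z + 1 / Z) * sinh (a / 2) \<le> sinh (a - b)"
    using S l(2) mult_right_mono[of "Z + 1 / Z" "2 * cosh (ln l / 2)" "sinh (a / 2)"] by simp
  \<comment> \<open>The second summand is \<open>sinh b \<ge> 0\<close>, so replacing
    \<open>ln l / 2\<close> by \<open>a / 2 - b\<close> can only increase
    \<open>cosh\<close>.\<close>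
  have "2 * sinh (a / 2) * cosh (a / 2 - b)
      = sinh (a / 2 + (a / 2 - b)) + sinh (a / 2 - (a / 2 - b))"
    unfolding sinh_add sinh_diff by simp
  then have "2 * sinh (a / 2) * cosh (a / 2 - b) \<ge> sinh (a - b)" using ab by simp
  then have "(2 * sinh (a / 2)) * cosh (ln l / 2) \<le> (2 * sinh (a / 2)) * cosh (a / 2 - b)"
    using l(2) by (simp add: mult_ac)
  then have "cosh (ln l / 2) \<le> cosh (a / 2 - b)"
    using S by (subst (asm) mult_le_cancel_left_pos) auto
  then have "ln l / 2 \<le> a / 2 - b"
    using l(1) lt by (subst (asm) cosh_real_nonneg_le_iff) auto
  then show "l \<le> exp (a - 2 * b)"
    using l(1) exp_le_cancel_iff[of "ln l" "a - 2 * b"] by simp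
qed

text \<open>The left-hand side is the bound available for the error term \<open>Y\<close> of
  \<open>tension_increment\<close>. The first estimate lets the factor \<open>1 - exp (- A)\<close>
  cancel there; in the second, \<open>L / (1 - L)\<close> is \<open>1 / (l - 1)\<close>.\<close>

lemma drift_decay:
  assumes gp: "good_pair a b" and "a \<le> A"
  defines "L \<equiv> 1 / translation_number a b"
  shows "exp (b - A / 2) / drift a b \<le> 1 - (1 - L) * (1 - exp (- A))"
    and "exp (b - A / 2) / drift a b \<le> L / (1 - L)"
proof -
  let ?Z = "drift a b"
  note gpd = good_pair_drift[OF gp]
  have l: "translation_number a b > 1" using good_pair_translation_number[OF gp] by simp
  have L: "0 < L" "L < 1" using l by (auto simp: L_def)
  \<comment> \<open>\<open>E \<le> L\<close> restates the bound on the translation number,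
    \<open>X \<le> E\<close> comes from \<open>b \<ge> 0\<close>, and \<open>h\<close> is the factor
    by which \<open>exp (b - a / 2)\<close> shrinks when the side grows from \<open>a\<close> to
    \<open>A\<close>.\<close>
  define E X h where "E = exp (2 * b - a)" and "X = exp (- a)" and "h = exp ((a - A) / 2)"
  have "b \<ge> 0" using gp by (simp add: good_pair_def)
  have "E = 1 / exp (a - 2 * b)" by (simp add: E_def exp_diff)
  then have E: "E \<le> L" "0 < E" using gpd(6) l by (simp_all add: L_def frac_le)
  have X: "X \<le> E" "0 < X" using \<open>b \<ge> 0\<close> by (auto simp: X_def E_def)
  have h: "0 < h" "h \<le> 1" using \<open>a \<le> A\<close> by (auto simp: h_def)
  have XE: "X * E \<ge> 0" using X E by simp
  have LL: "L * (1 + L) \<le> L / (1 - L)"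
  proof -
    have "L * ((1 + L) * (1 - L)) \<le> L * 1" using L by (intro mult_left_mono) (auto simp: algebra_simps)
    then show ?thesis using L by (simp add: field_simps)
  qed
  have L1: "exp (b - A / 2) / ?Z = h * (exp (b - a / 2) / ?Z)"
    by (simp add: h_def exp_add[symmetric] field_simps)
  have "h * h = exp (a - A)" by (simp add: h_def exp_add[symmetric] field_simps)
  then have hX: "exp (- A) = X * (h * h)" by (simp add: X_def exp_add[symmetric])
  \<comment> \<open>The case \<open>A = a\<close>, split by the term at which the minimum in
    \<open>drift\<close> is attained.\<close>
  have *: "exp (b - a / 2) / ?Z \<le> 1 - (1 - L) * (1 - X) \<and> exp (b - a / 2) / ?Z \<le> L * (1 + L)"
  proof (cases "?Z = sqrt (translation_number a b)")
    case True
    have "exp (b - a / 2) = sqrt E"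
      by (rule real_sqrt_unique[symmetric]) (simp_all add: E_def power2_eq_square exp_add[symmetric])
    also have "\<dots> \<le> sqrt L" using E by simp
    finally have "exp (b - a / 2) / ?Z \<le> sqrt L / ?Z"
      using gpd(3) by (intro divide_right_mono) auto
    also have "\<dots> = L" using l by (simp add: True L_def real_sqrt_divide)
    finally have "exp (b - a / 2) / ?Z \<le> L" .
    moreover have "L \<le> 1 - (1 - L) * (1 - X)" using L X by (simp add: algebra_simps)
    moreover have "L \<le> L * (1 + L)" using L by (simp add: algebra_simps)
    ultimately show ?thesis by linarith
  next
    case False
    then have "?Z = cosh (a - b) / cosh (a / 2)" by (simp add: drift_def min_def split: if_splits)
    moreover have "exp (b - a / 2) * cosh (a / 2) = (exp (a - b) / 2) * (E * (1 + X))"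
      by (simp add: cosh_def E_def X_def algebra_simps add_divide_distrib flip: exp_add)
    moreover have "cosh (a - b) = (exp (a - b) / 2) * (1 + X * E)"
      by (simp add: cosh_def E_def X_def algebra_simps add_divide_distrib flip: exp_add)
    moreover have "exp (b - a / 2) / ?Z = exp (b - a / 2) * cosh (a / 2) / cosh (a - b)"
      by (simp add: calculation(1))
    ultimately have eq: "exp (b - a / 2) / ?Z = E * (1 + X) / (1 + X * E)"
      by (simp only: mult_divide_mult_cancel_left_if) simp
    \<comment> \<open>This is the first claim with the denominator \<open>1 + X * E\<close>
      cleared.\<close>
    have "(1 - L) * ((1 - X) * (1 + X * E)) \<le> (1 - E) * 1"
    proof (rule mult_mono)
      have "(1 - X) * (1 + X * E) = 1 - X * (1 - E) - X * (X * E)" by (simp add: algebra_simps)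
      also have "\<dots> \<le> 1"
        using X E L XE mult_nonneg_nonneg[of X "1 - E"] mult_nonneg_nonneg[of X "X * E"] by linarith
      finally show "(1 - X) * (1 + X * E) \<le> 1" .
    qed (use E L X XE in auto)
    then have 1: "E * (1 + X) / (1 + X * E) \<le> 1 - (1 - L) * (1 - X)"
      using XE by (subst pos_divide_le_eq) (auto simp: algebra_simps)
    have "E * (1 + X) / (1 + X * E) \<le> E * (1 + X)"
      using divide_left_mono[of 1 "1 + X * E" "E * (1 + X)"] X E XE by simp
    also have "\<dots> \<le> L * (1 + L)" using X E L by (intro mult_mono) auto
    finally show ?thesis using 1 eq by simp
  qed
  have Zpos: "0 \<le> exp (b - a / 2) / ?Z" using gpd(3) by simp
  have "h * (exp (b - a / 2) / ?Z) \<le> h * (1 - (1 - L) * (1 - X))"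
    using * h by (intro mult_left_mono) auto
  \<comment> \<open>The two sides differ by \<open>(1 - h) * (L - X * h * (1 - L))\<close>, which is
    nonnegative since \<open>X \<le> E \<le> L\<close>.\<close>
  also have "\<dots> \<le> 1 - (1 - L) * (1 - X * (h * h))"
  proof -
    have "X * h * (1 - L) \<le> L * 1 * 1" using X E L h by (intro mult_mono) auto
    then have "(1 - h) * (L - X * h * (1 - L)) \<ge> 0" using h by (intro mult_nonneg_nonneg) auto
    then show ?thesis by (simp add: algebra_simps)
  qed
  finally show "exp (b - A / 2) / ?Z \<le> 1 - (1 - L) * (1 - exp (- A))" by (simp add: L1 hX)
  have "h * (exp (b - a / 2) / ?Z) \<le> exp (b - a / 2) / ?Z"
    using h Zpos by (intro mult_left_le_one_le) auto
  then show "exp (b - A / 2) / ?Z \<le> L / (1 - L)" using L1 * LL by linarith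
qed

section \<open>Growth along a chain and the increment of the tension\<close>

text \<open>Divide the first inequality of \<open>exp_ptolemy\<close> by
  \<open>exp (?yq / 2)\<close> and insert the assumed drift, which bounds
  \<open>exp ((?yp - ?yq) / 2)\<close> by \<open>1 / ?Z\<close>. By \<open>sinh_gromov_ge\<close>
  the left-hand side exceeds \<open>sinh (?B / 2) / ?Z\<close> by enough to leave the same bound one
  point later.\<close>

lemma drift_step:
  assumes gp: "good_pair a b"
    and H: "y \<in> upper_half_plane" "p \<in> upper_half_plane" "q \<in> upper_half_plane" "r \<in> upper_half_plane"
    and A: "a \<le> hyp_dist p q" and B: "a \<le> hyp_dist q r" and G: "gromov_product p r q \<le> b"
    and drift: "drift a b \<le> exp ((hyp_dist y q - hyp_dist y p) / 2)"
  shows "drift a b \<le> exp ((hyp_dist y r - hyp_dist y q) / 2)"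
proof -
  let ?Z = "drift a b"
  note gpd = good_pair_drift[OF gp]
  let ?yp = "hyp_dist y p" and ?yq = "hyp_dist y q" and ?yr = "hyp_dist y r"
    and ?A = "hyp_dist p q" and ?B = "hyp_dist q r" and ?C = "hyp_dist p r"
  have SA: "sinh (?A / 2) > 0" and SB: "sinh (?B / 2) > 0" using A B gpd(1) by auto
  have "b < a" "0 \<le> a" using gpd(1,2) by auto
  then have "?Z * sinh (?A / 2) + sinh (?B / 2) / ?Z \<le> sinh ((?A + ?B) / 2 - b)"
    using gpd A B by (intro sinh_gromov_ge) auto
  also have "\<dots> \<le> sinh (?C / 2)"
    using G by (simp add: gromov_product_def field_simps)
  also have "\<dots> \<le> exp ((?yp - ?yq) / 2) * sinh (?B / 2) + exp ((?yr - ?yq) / 2) * sinh (?A / 2)"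
  proof -
    have "exp (?yp / 2) = exp (?yq / 2) * exp ((?yp - ?yq) / 2)"
      "exp (?yr / 2) = exp (?yq / 2) * exp ((?yr - ?yq) / 2)"
      by (simp_all add: field_simps flip: exp_add)
    then show ?thesis using exp_ptolemy(1)[OF H]
      by (simp add: mult.assoc flip: distrib_left)
  qed
  also have "\<dots> \<le> 1 / ?Z * sinh (?B / 2) + exp ((?yr - ?yq) / 2) * sinh (?A / 2)"
  proof -
    have "exp ((?yp - ?yq) / 2) = 1 / exp ((?yq - ?yp) / 2)"
      by (simp add: field_simps flip: exp_add)
    also have "\<dots> \<le> 1 / ?Z" using drift gpd(3) by (intro divide_left_mono) auto
    finally show ?thesis using SB by (intro add_right_mono mult_right_mono) auto
  qed
  finally have "?Z * sinh (?A / 2) \<le> exp ((?yr - ?yq) / 2) * sinh (?A / 2)" by simp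
  then show ?thesis using SA by (subst (asm) mult_le_cancel_right_pos) auto
qed

lemma tension_increment:
  assumes gp: "good_pair a b" and l: "l = translation_number a b"
    and H: "y \<in> upper_half_plane" "p \<in> upper_half_plane" "q \<in> upper_half_plane" "r \<in> upper_half_plane"
    and A: "a \<le> hyp_dist p q" and B: "a \<le> hyp_dist q r" and G: "gromov_product p r q \<le> b"
    and drift: "drift a b \<le> exp ((hyp_dist y q - hyp_dist y p) / 2)"
  shows "\<bar>hyp_dist y q + hyp_dist p r - hyp_dist p q - hyp_dist y r\<bar> \<le> 2 / (l - 1)"
proof -
  let ?yp = "hyp_dist y p" and ?yq = "hyp_dist y q" and ?yr = "hyp_dist y r"
    and ?A = "hyp_dist p q" and ?B = "hyp_dist q r" and ?C = "hyp_dist p r"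
  define T where "T = ?yq + ?C - ?A - ?yr"
  define Y where "Y = exp ((?yp + ?B - ?yq - ?C) / 2)"
  have l1: "l > 1" using good_pair_translation_number[OF gp] l by simp
  have e1: "1 + 1 / (l - 1) \<le> exp (1 / (l - 1))" by (rule exp_ge_add_one_self)
  have "drift a b > 0" using good_pair_drift(3)[OF gp] by linarith
  \<comment> \<open>The Gromov product gives \<open>(?B - ?C) / 2 \<le> b - ?A / 2\<close>, and the
    drift bounds the denominator from below.\<close>
  have "Y = exp ((?B - ?C) / 2) / exp ((?yq - ?yp) / 2)"
    by (simp add: Y_def field_simps flip: exp_diff)
  also have "\<dots> \<le> exp (b - ?A / 2) / drift a b"
    using drift G \<open>drift a b > 0\<close>
    by (intro frac_le) (auto simp: gromov_product_def field_simps)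
  finally have Y: "Y \<le> exp (b - ?A / 2) / drift a b" .
  have "1 / l / (1 - 1 / l) = 1 / (l - 1)" using l1 by (simp add: field_simps)
  then have Y2: "Y \<le> 1 / (l - 1)"
    using Y drift_decay(2)[OF gp A] by (simp add: l)
  have Y1: "(1 - 1 / l) * (1 - exp (- ?A)) \<le> 1 - Y"
    using Y drift_decay(1)[OF gp A] by (simp add: l)
  have AB: "?A > 0" "?B > 0" using A B good_pair_drift(1)[OF gp] by auto
  have expS: "2 * sinh (t / 2) = exp (t / 2) * (1 - exp (- t))" for t :: real
    by (simp add: sinh_def algebra_simps flip: exp_add)
  have "exp ((?yq + ?C) / 2) \<le> exp ((?yp + ?B) / 2) + exp ((?yr + ?A) / 2) * (1 - exp (- ?A))"
    using exp_ptolemy(2)[OF H] expS[of ?A]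
    by (simp add: add_divide_distrib exp_add mult.assoc mult.left_commute[of 2])
  moreover have "exp ((?yq + ?C) / 2) = exp ((?yr + ?A) / 2) * exp (T / 2)"
    "exp ((?yp + ?B) / 2) = exp ((?yr + ?A) / 2) * (exp (T / 2) * Y)"
    by (simp_all add: T_def Y_def field_simps flip: exp_add)
  ultimately have "exp (T / 2) * (1 - Y) \<le> 1 - exp (- ?A)"
    by (simp add: mult.assoc flip: distrib_left) (simp add: algebra_simps)
  \<comment> \<open>\<open>Y1\<close> replaces \<open>1 - Y\<close> by a multiple of
    \<open>1 - exp (- ?A)\<close>, which is positive and cancels.\<close>
  then have "exp (T / 2) * (1 - 1 / l) * (1 - exp (- ?A)) \<le> 1 * (1 - exp (- ?A))"
    using order_trans[OF mult_left_mono[OF Y1, of "exp (T / 2)"]] by (simp add: mult.assoc)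
  then have "exp (T / 2) * (1 - 1 / l) \<le> 1"
    using AB by (subst (asm) mult_le_cancel_right) auto
  then have "exp (T / 2) \<le> 1 / (1 - 1 / l)" using l1 by (subst pos_le_divide_eq) auto
  moreover have "1 / (1 - 1 / l) = 1 + 1 / (l - 1)" using l1 by (simp add: field_simps)
  ultimately have "exp (T / 2) \<le> exp (1 / (l - 1))" using e1 by linarith
  then have up: "T \<le> 2 / (l - 1)" by simp
  have comm: "hyp_dist r p = ?C" "hyp_dist q p = ?A" using H hyp_dist_commute by blast+
  \<comment> \<open>The same Ptolemy inequality with \<open>p\<close>, \<open>q\<close>,
    \<open>r\<close> permuted cyclically, so that the diagonals become \<open>y r\<close> and
    \<open>q p\<close>.\<close>
  have "exp ((?yr + ?A) / 2) \<le> exp ((?yq + ?C) / 2) + exp ((?yp + ?B) / 2) * (1 - exp (- ?B))"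
    using exp_ptolemy(2)[OF H(1) H(3) H(4) H(2)] expS[of ?B]
    by (simp add: comm add_divide_distrib exp_add mult.assoc mult.left_commute[of 2])
  moreover have "exp ((?yr + ?A) / 2) = exp ((?yq + ?C) / 2) * exp (- T / 2)"
    "exp ((?yp + ?B) / 2) = exp ((?yq + ?C) / 2) * Y"
    by (simp_all add: T_def Y_def field_simps flip: exp_add)
  ultimately have "exp ((?yq + ?C) / 2) * exp (- T / 2)
      \<le> exp ((?yq + ?C) / 2) * (1 + Y * (1 - exp (- ?B)))"
    by (simp only: distrib_left mult.assoc mult_1_right)
  then have "exp (- T / 2) \<le> 1 + Y * (1 - exp (- ?B))"
    by (subst (asm) mult_le_cancel_left_pos) auto
  moreover have "Y * (1 - exp (- ?B)) \<le> Y * 1"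
    by (intro mult_left_mono) (auto simp: Y_def)
  ultimately have "exp (- T / 2) \<le> exp (1 / (l - 1))" using Y2 e1 by linarith
  then have "- T \<le> 2 / (l - 1)" by simp
  with up show ?thesis by (simp add: T_def abs_le_iff)
qed

lemma good_chain_drift:
  assumes gp: "good_pair a b" and gc: "good_chain a b n x" and "Suc j \<le> n"
  shows "drift a b \<le> exp ((hyp_dist (x 0) (x (Suc j)) - hyp_dist (x 0) (x j)) / 2)"
  using \<open>Suc j \<le> n\<close>
proof (induction j)
  case 0
  have H: "x 0 \<in> upper_half_plane" "x (Suc 0) \<in> upper_half_plane" using gc 0 by (auto simp: good_chain_def)
  have "a \<le> hyp_dist (x (Suc 0)) (x 0)" using gc 0 by (auto simp: good_chain_def)
  then have d: "a \<le> hyp_dist (x 0) (x (Suc 0))" using hyp_dist_commute[OF H] by simp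
  have "b \<ge> 0" using gp by (simp add: good_pair_def)
  \<comment> \<open>At the first edge the drift is at least \<open>exp (a / 2)\<close>, which
    already dominates the first term of the minimum.\<close>
  have "translation_number a b \<le> exp a"
    using good_pair_drift(6)[OF gp] exp_le_cancel_iff[of "a - 2 * b" a] \<open>b \<ge> 0\<close> by linarith
  then have "sqrt (translation_number a b) \<le> sqrt (exp a)" by simp
  also have "sqrt (exp a) = exp (a / 2)"
    by (rule real_sqrt_unique) (simp_all add: power2_eq_square flip: exp_add)
  also have "\<dots> \<le> exp ((hyp_dist (x 0) (x (Suc 0)) - hyp_dist (x 0) (x 0)) / 2)"
    using d H by (simp add: hyp_dist_self)
  finally show ?case by (simp add: drift_def)
next
  case (Suc j)
  have H: "x i \<in> upper_half_plane" if "i \<le> n" for i using gc that by (auto simp: good_chain_def)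
  have d: "a \<le> hyp_dist (x i) (x (Suc i))" if "i < n" for i
    using gc that H[of i] H[of "Suc i"] hyp_dist_commute[of "x i" "x (Suc i)"]
    by (auto simp: good_chain_def)
  have "gromov_product (x (Suc j - 1)) (x (Suc j + 1)) (x (Suc j)) \<le> b"
    using gc Suc.prems unfolding good_chain_def by (elim conjE bspec) auto
  then show ?case using Suc H d
    by (intro drift_step[OF gp, of _ "x j" "x (Suc j)"]) auto
qed

section \<open>Tension of a growing chain\<close>

lemma tension_2: "tension 2 x = 0"
  by (simp add: tension_def numeral_2_eq_2)

text \<open>Both sums gain the term \<open>j = k\<close>, and the closing distance moves from
  \<open>x k\<close> to \<open>x (Suc k)\<close>.\<close>

lemma tension_Suc:
  assumes "k \<ge> 2"
  shows "tension (Suc k) x = tension k x + (hyp_dist (x 0) (x k) + hyp_dist (x (k - 1)) (x (Suc k))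
      - hyp_dist (x (k - 1)) (x k) - hyp_dist (x 0) (x (Suc k)))"
proof -
  \<comment> \<open>This form removes the truncated subtractions and makes both sums nonempty after
    the extension.\<close>
  obtain m where "k = Suc (Suc m)" using assms by (metis add_2_eq_Suc le_Suc_ex)
  then show ?thesis by (simp add: tension_def)
qed

theorem theorem1p6:
  fixes a b l :: real and n :: nat and x :: "nat \<Rightarrow> complex"
  assumes "good_pair a b"
    and "l = translation_number a b"
    and "n \<ge> 2"
    and "good_chain a b n x"
  shows "\<bar>tension n x\<bar> \<le> (real n - 2) * (2 / (l - 1))"
proof -
  have H: "x i \<in> upper_half_plane" if "i \<le> n" for i using assms(4) that by (auto simp: good_chain_def)
  have d: "a \<le> hyp_dist (x i) (x (Suc i))" if "i < n" for i
    using assms(4) that H[of i] H[of "Suc i"] hyp_dist_commute[of "x i" "x (Suc i)"]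
    by (auto simp: good_chain_def)
  have "\<bar>tension k x\<bar> \<le> (real k - 2) * (2 / (l - 1))" if "2 \<le> k" "k \<le> n" for k
    using that
  proof (induction k rule: dec_induct)
    case base
    show ?case by (simp add: tension_2)
  next
    case (step k)
    \<comment> \<open>\<open>good_chain_drift\<close> at \<open>m = k - 1\<close> supplies the drift
      from \<open>x (k - 1)\<close> to \<open>x k\<close>.\<close>
    obtain m where m: "k = Suc m" using step.hyps by (metis add_2_eq_Suc le_Suc_ex)
    have "gromov_product (x (k - 1)) (x (k + 1)) (x k) \<le> b"
      using assms(4) step by (simp add: good_chain_def)
    then have "\<bar>hyp_dist (x 0) (x k) + hyp_dist (x (k - 1)) (x (Suc k))
        - hyp_dist (x (k - 1)) (x k) - hyp_dist (x 0) (x (Suc k))\<bar> \<le> 2 / (l - 1)"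
      using good_chain_drift[OF assms(1,4), of m] step.prems H d m
      by (intro tension_increment[OF assms(1,2)]) auto
    then have "\<bar>tension (Suc k) x\<bar> \<le> (real k - 2) * (2 / (l - 1)) + 2 / (l - 1)"
      using step tension_Suc[of k x] by linarith
    then show ?case by (simp add: ring_distribs del: times_divide_eq_right)
  qed
  then show ?thesis using assms(3) by blast
qed

end
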